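(* Let $G$ be a finite simple graph and let $M$ be a matching of $G$. Then the degree of $M$ in the skeleton $\mathcal{G}(\mathcal{M}(G))$ of the matching polytope of $G$ is $$d(M)=\nu_P(M)+\nu_C(M),$$ where $\nu_P(M)$ is the number of $M$-good paths of $G$ and $\nu_C(M)$ is the number of $M$-good cycles of $G$.
   Context: For a finite simple graph $G=(V,E)$, a matching is a set of pairwise disjoint (non-adjacent) edges; the empty set is a matching. For $F\subseteq E$ the incidence vector $\chi_F\in\mathbb{R}^E$ has $\chi_F(e)=1$ if $e\in F$ and $0$ otherwise. The matching polytope $\mathcal{M}(G)$ is the convex hull of the incidence vectors of all matchings of $G$; its vertices are exactly the vectors $\chi_M$, $M$ a matching. The skeleton $\mathcal{G}(\mathcal{M}(G))$ is the graph whose vertices are the vertices of $\mathcal{M}(G)$ and whose edges are the edges (1-dimensional faces) of $\mathcal{M}(G)$. Identifying $M$ with $\chi_M$, $d(M)$ denotes the degree of $\chi_M$ in the skeleton. A vertex is $M$-saturated if some edge of $M$ is incident to it, and $M$-unsaturated otherwise. A path is a sequence of distinct vertices $v_1\dots v_{k+1}$, $k\ge 1$, with consecutive vertices adjacent, identified with its set of edges (so paths are counted as subgraphs); its pendant edges are its first and last edges and its pendant vertices are $v_1,v_{k+1}$. A path or cycle is $M$-alternating if of any two consecutive edges exactly one lies in $M$ (a one-edge path is $M$-alternating). An $M$-alternating path $P$ is an oo-$M$-path if both its pendant edges belong to $M$; a cc-$M$-path if both its pendant vertices are $M$-unsaturated; an oc-$M$-path if one of its pendant edges belongs to $M$ and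 one of its pendant vertices is $M$-unsaturated. An $M$-good path is an oo-, cc- or oc-$M$-path. An $M$-good cycle is an $M$-alternating cycle of $G$. *)

theory Defs
  imports "HOL-Analysis.Analysis"
begin

section \<open>Finite simple graphs\<close>

type_synonym 'v graph = "'v set \<times> 'v set set"

abbreviation verts :: "'v graph \<Rightarrow> 'v set" where "verts \<equiv> fst"
abbreviation edges :: "'v graph \<Rightarrow> 'v set set" where "edges \<equiv> snd"

definition finite_simple_graph :: "'v graph \<Rightarrow> bool" where
  "finite_simple_graph G \<longleftrightarrow>
     finite (verts G) \<and> (\<forall>e\<in>edges G. e \<subseteq> verts G \<and> card e = 2)"

definition vertex_degree :: "'v graph \<Rightarrow> 'v \<Rightarrow> nat" where
  "vertex_degree G v = card {e \<in> edges G. v \<in> e}"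

definition matching :: "'v graph \<Rightarrow> 'v set set \<Rightarrow> bool" where
  "matching G M \<longleftrightarrow> M \<subseteq> edges G \<and> pairwise disjnt M"

definition saturated :: "'v set set \<Rightarrow> 'v \<Rightarrow> bool" where
  "saturated M v \<longleftrightarrow> (\<exists>e\<in>M. v \<in> e)"


section \<open>The matching polytope and its skeleton\<close>

text \<open>
  The space of real vectors indexed by the edges of \<open>G\<close> is represented as the coordinate subspace
  of \<^typ>\<open>real ^ ('v::finite set)\<close> in which every coordinate that is not an edge vanishes.
  (A type indexed exactly by the edges would exclude edgeless graphs.)
\<close>

definition incidence_vector :: "'v::finite set set \<Rightarrow> real ^ ('v set)" where
  "incidence_vector F = (\<chi> e. if e \<in> F then 1 else 0)"

definition matching_polytope :: "'v::finite graph \<Rightarrow> (real ^ ('v set)) set" where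
  "matching_polytope G = convex hull (incidence_vector ` {M. matching G M})"

text \<open>
  A one-dimensional face of a polytope is the segment joining its two end points; it is
  recorded as the unordered pair of these.
\<close>

definition skeleton :: "'a::euclidean_space set \<Rightarrow> 'a graph" where
  "skeleton P =
     ({x. x extreme_point_of P},
      {{x, y} | x y. x extreme_point_of P \<and> y extreme_point_of P \<and> closed_segment x y edge_of P})"


section \<open>Good paths and good cycles\<close>

definition walk_edges :: "'v list \<Rightarrow> 'v set list" where
  "walk_edges vs = map2 (\<lambda>u v. {u, v}) vs (tl vs)"

definition cycle_edges :: "'v list \<Rightarrow> 'v set list" where
  "cycle_edges vs = walk_edges (vs @ [hd vs])"

definition is_path :: "'v graph \<Rightarrow> 'v list \<Rightarrow> bool" where
  "is_path G vs \<longleftrightarrow> length vs \<ge> 2 \<and> distinct vs \<and> set vs \<subseteq> verts G \<and>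
     set (walk_edges vs) \<subseteq> edges G"

definition is_cycle :: "'v graph \<Rightarrow> 'v list \<Rightarrow> bool" where
  "is_cycle G vs \<longleftrightarrow> length vs \<ge> 3 \<and> distinct vs \<and> set vs \<subseteq> verts G \<and>
     set (cycle_edges vs) \<subseteq> edges G"

definition alternating_path :: "'v graph \<Rightarrow> 'v set set \<Rightarrow> 'v list \<Rightarrow> bool" where
  "alternating_path G M vs \<longleftrightarrow> is_path G vs \<and>
     successively (\<lambda>e f. (e \<in> M) \<noteq> (f \<in> M)) (walk_edges vs)"

text \<open>In a cycle, the last and the first edge are consecutive as well.\<close>

definition alternating_cycle :: "'v graph \<Rightarrow> 'v set set \<Rightarrow> 'v list \<Rightarrow> bool" where
  "alternating_cycle G M vs \<longleftrightarrow> is_cycle G vs \<and>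
     successively (\<lambda>e f. (e \<in> M) \<noteq> (f \<in> M)) (cycle_edges vs @ [hd (cycle_edges vs)])"

definition oo_path :: "'v graph \<Rightarrow> 'v set set \<Rightarrow> 'v list \<Rightarrow> bool" where
  "oo_path G M vs \<longleftrightarrow> alternating_path G M vs \<and>
     hd (walk_edges vs) \<in> M \<and> last (walk_edges vs) \<in> M"

definition cc_path :: "'v graph \<Rightarrow> 'v set set \<Rightarrow> 'v list \<Rightarrow> bool" where
  "cc_path G M vs \<longleftrightarrow> alternating_path G M vs \<and>
     \<not> saturated M (hd vs) \<and> \<not> saturated M (last vs)"

definition oc_path :: "'v graph \<Rightarrow> 'v set set \<Rightarrow> 'v list \<Rightarrow> bool" where
  "oc_path G M vs \<longleftrightarrow> alternating_path G M vs \<and>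
     (hd (walk_edges vs) \<in> M \<or> last (walk_edges vs) \<in> M) \<and>
     (\<not> saturated M (hd vs) \<or> \<not> saturated M (last vs))"

text \<open>
  Paths and cycles are counted as subgraphs, that is, as edge sets: a vertex sequence, its
  reversal and (for cycles) its rotations are the same object.
\<close>

definition good_paths :: "'v graph \<Rightarrow> 'v set set \<Rightarrow> 'v set set set" where
  "good_paths G M =
     {set (walk_edges vs) | vs. oo_path G M vs \<or> cc_path G M vs \<or> oc_path G M vs}"

definition good_cycles :: "'v graph \<Rightarrow> 'v set set \<Rightarrow> 'v set set set" where
  "good_cycles G M = {set (cycle_edges vs) | vs. alternating_cycle G M vs}"

end

theory Submission imports Defs begin

text \<open>
  Two vertices \<open>\<chi>\<^sub>M\<close> and \<open>\<chi>\<^sub>N\<close> of the matching polytope are adjacent iff \<open>M \<noteq> N\<close> and the symmetric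
  difference \<open>S\<close> of \<open>M\<close> and \<open>N\<close> is connected. If \<open>S\<close> splits into two parts without common vertices,
  exchanging one part gives two further matchings whose midpoint is that of \<open>\<chi>\<^sub>M\<close> and \<open>\<chi>\<^sub>N\<close>.
  If \<open>S\<close> is connected, the segment is the face cut out by \<open>x\<^sub>e = 1\<close> for \<open>e \<in> M \<inter> N\<close>, \<open>x\<^sub>e = 0\<close> for
  \<open>e \<notin> M \<union> N\<close> and \<open>x\<^sub>e + x\<^sub>f = 1\<close> for incident \<open>e, f \<in> S\<close>: connectedness propagates the choice between
  \<open>M\<close> and \<open>N\<close> from one edge of \<open>S\<close> to all others. Finally, a nonempty connected \<open>S\<close> has maximum
  degree at most two, hence is a path or a cycle, alternating in \<open>M\<close>, and the conditions on the ends of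
  a good path say exactly that exchanging along it produces a matching again.
\<close>

section \<open>Connected edge sets and exchanges of matchings\<close>

text \<open>Connectedness of the line graph as a closure condition: no proper nonempty part is
  closed under incidence. The empty set counts as connected, and the condition serves directly as a
  propagation principle.\<close>

definition edge_connected :: "'v set set \<Rightarrow> bool" where
  "edge_connected S \<longleftrightarrow>
     (\<forall>T\<subseteq>S. T \<noteq> {} \<longrightarrow> (\<forall>e\<in>T. \<forall>f\<in>S. e \<inter> f \<noteq> {} \<longrightarrow> f \<in> T) \<longrightarrow> T = S)"

lemma edge_connectedD:
  assumes "edge_connected S" "T \<subseteq> S" "T \<noteq> {}"
    and "\<And>e f. e \<in> T \<Longrightarrow> f \<in> S \<Longrightarrow> e \<inter> f \<noteq> {} \<Longrightarrow> f \<in> T"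
  shows "T = S"
  using assms unfolding edge_connected_def by blast

lemma matching_edge_eq:
  assumes "matching G M" "e \<in> M" "f \<in> M" "v \<in> e" "v \<in> f"
  shows "e = f"
  using assms unfolding matching_def pairwise_def disjnt_def by blast

lemma matchingI:
  assumes "M \<subseteq> edges G" "\<And>e f v. e \<in> M \<Longrightarrow> f \<in> M \<Longrightarrow> v \<in> e \<Longrightarrow> v \<in> f \<Longrightarrow> e = f"
  shows "matching G M"
  using assms unfolding matching_def pairwise_def disjnt_def by blast

text \<open>Only a kept edge of \<open>M\<close> and a new edge from \<open>T\<close> could clash.
  If the kept edge is also in \<open>N\<close>, both edges lie in the matching \<open>N\<close>;
  otherwise it belongs to the symmetric difference, and touching \<open>T\<close> would have forced
  it into \<open>T\<close>.\<close>

lemma matching_exchange: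
  assumes M: "matching G M" and N: "matching G N" and T: "T \<subseteq> sym_diff M N"
    and closed: "\<And>e f. e \<in> T \<Longrightarrow> f \<in> sym_diff M N \<Longrightarrow> e \<inter> f \<noteq> {} \<Longrightarrow> f \<in> T"
  shows "matching G (sym_diff M T)"
proof (rule matchingI)
  show "sym_diff M T \<subseteq> edges G" using M N T by (auto simp: matching_def)
next
  have mixed: False if "e \<in> M - T" "f \<in> T - M" "v \<in> e" "v \<in> f" for e f v
  proof (cases "e \<in> N")
    case True
    then have "e = f" using that T matching_edge_eq[OF N, of e f v] by blast
    then show False using that by blast
  next
    case False
    then have "e \<in> T" using that closed[of f e] by blast
    then show False using that by blast
  qed
  fix e f v assume ef: "e \<in> sym_diff M T" "f \<in> sym_diff M T" and v: "v \<in> e" "v \<in> f"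
  consider "e \<in> M" "f \<in> M" | "e \<in> N" "f \<in> N" | "e \<in> M - T" "f \<in> T - M" | "f \<in> M - T" "e \<in> T - M"
    using ef T by blast
  then show "e = f"
    by cases (use v matching_edge_eq[OF M, of e f v] matching_edge_eq[OF N, of e f v]
        mixed[of e f v] mixed[of f e v] in simp_all)
qed

section \<open>Adjacency on the matching polytope\<close>

text \<open>Summing all inequalities in \<open>C\<close> gives a single functional that equals its
  bound on \<open>T\<close> and stays strictly below it on \<open>S - T\<close>. Hence the affine
  hull of \<open>T\<close> misses the convex hull of the remaining points.\<close>

lemma convex_hull_face_of_if_supported:
  fixes S :: "'a::euclidean_space set" and C :: "('a \<times> real) set"
  assumes "finite S" "T \<subseteq> S" "finite C"
    and le: "\<And>x c b. x \<in> S \<Longrightarrow> (c, b) \<in> C \<Longrightarrow> c \<bullet> x \<le> b"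
    and eq: "\<And>x c b. x \<in> T \<Longrightarrow> (c, b) \<in> C \<Longrightarrow> c \<bullet> x = b"
    and strict: "\<And>x. x \<in> S - T \<Longrightarrow> \<exists>(c, b)\<in>C. c \<bullet> x < b"
  shows "(convex hull T) face_of (convex hull S)"
proof (rule face_of_convex_hulls)
  define a where "a = (\<Sum>p\<in>C. fst p)"
  define \<beta> where "\<beta> = (\<Sum>p\<in>C. snd p)"
  have a: "a \<bullet> x = (\<Sum>p\<in>C. fst p \<bullet> x)" for x
    by (simp add: a_def inner_sum_left)
  have "affine hull T \<subseteq> {x. a \<bullet> x = \<beta>}"
  proof (rule hull_minimal)
    show "T \<subseteq> {x. a \<bullet> x = \<beta>}"
      using eq by (auto simp: a \<beta>_def intro!: sum.cong)
  qed (rule affine_hyperplane)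
  moreover have "convex hull (S - T) \<subseteq> {x. a \<bullet> x < \<beta>}"
  proof (rule hull_minimal)
    show "S - T \<subseteq> {x. a \<bullet> x < \<beta>}"
    proof (clarify, unfold a \<beta>_def, rule sum_strict_mono_ex1)
      fix x assume x: "x \<in> S" "x \<notin> T"
      show "\<forall>p\<in>C. fst p \<bullet> x \<le> snd p"
        using le[OF x(1)] by auto
      show "\<exists>p\<in>C. fst p \<bullet> x < snd p"
        using strict[of x] x by force
    qed (rule \<open>finite C\<close>)
  qed (rule convex_halfspace_lt)
  ultimately show "affine hull T \<inter> convex hull (S - T) = {}"
    by fastforce
qed (use assms in auto)

lemma incidence_vector_nth [simp]: "incidence_vector F $ e = (if e \<in> F then 1 else 0)"
  by (simp add: incidence_vector_def)

lemma inj_incidence_vector: "inj incidence_vector"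
  by (rule injI) (auto simp: vec_eq_iff split: if_splits)

lemma incidence_vector_eq_iff [simp]: "incidence_vector M = incidence_vector N \<longleftrightarrow> M = N"
  using inj_incidence_vector by (auto dest: injD)

text \<open>A coordinate where \<open>L\<close> differs from \<open>M\<close> forces
  \<open>u = 1\<close>, and one where it differs from \<open>N\<close> forces
  \<open>u = 0\<close>.\<close>

lemma incidence_vector_in_segment:
  assumes "incidence_vector L \<in> closed_segment (incidence_vector M) (incidence_vector N)"
  shows "L = M \<or> L = N"
proof -
  obtain u where u: "0 \<le> u" "u \<le> 1" and
    "incidence_vector L = (1 - u) *\<^sub>R incidence_vector M + u *\<^sub>R incidence_vector N"
    using assms unfolding closed_segment_def by auto
  then have L: "(if e \<in> L then 1 else 0) =
      (1 - u) * (if e \<in> M then 1 else 0) + u * (if e \<in> N then 1 else 0)" for e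
    unfolding vec_eq_iff by simp
  show ?thesis
  proof (rule ccontr)
    assume "\<not> ?thesis"
    then obtain e f where "(e \<in> L) \<noteq> (e \<in> M)" "(f \<in> L) \<noteq> (f \<in> N)"
      by blast
    then show False
      using L[of e] L[of f] by (auto split: if_splits)
  qed
qed

lemma segment_face_of_matching_polytope:
  fixes G :: "'v::finite graph"
  assumes M: "matching G M" and N: "matching G N" and conn: "edge_connected (sym_diff M N)"
  shows "closed_segment (incidence_vector M) (incidence_vector N) face_of matching_polytope G"
proof -
  \<comment> \<open>A pair \<open>(c, b)\<close> encodes the inequality
    \<open>c \<bullet> x \<le> b\<close>. The complement in the second family ranges over the whole
    index type, so it also covers coordinates that are not edges.\<close>
  define C :: "((real ^ ('v set)) \<times> real) set" where
    "C = (\<lambda>e. (axis e 1, 1)) ` (M \<inter> N) \<union> (\<lambda>e. (- axis e 1, 0)) ` (- (M \<union> N)) \<union>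
         (\<lambda>(e, f). (axis e 1 + axis f 1, 1)) ` {(e, f). e \<in> M - N \<and> f \<in> N - M \<and> e \<inter> f \<noteq> {}}"
  let ?I = "incidence_vector :: 'v set set \<Rightarrow> real ^ ('v set)"
  have "(convex hull {?I M, ?I N}) face_of (convex hull (?I ` {M. matching G M}))"
  proof (rule convex_hull_face_of_if_supported[where C = C])
    show "finite (?I ` {M. matching G M})" "finite C"
      by (simp_all add: C_def)
    show "{?I M, ?I N} \<subseteq> ?I ` {M. matching G M}"
      using M N by blast
  next
    fix x c b assume x: "x \<in> ?I ` {M. matching G M}" and "(c, b) \<in> C"
    then show "c \<bullet> x \<le> b"
      by (auto simp: C_def inner_axis' inner_add_left dest: matching_edge_eq split: if_splits)
  next
    fix x c b assume x: "x \<in> {?I M, ?I N}" and "(c, b) \<in> C"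
    then show "c \<bullet> x = b"
      by (auto simp: C_def inner_axis' inner_add_left)
  next
    fix x assume "x \<in> ?I ` {M. matching G M} - {?I M, ?I N}"
    then obtain L where L: "x = ?I L" "matching G L" "L \<noteq> M" "L \<noteq> N"
      by blast
    show "\<exists>(c, b)\<in>C. c \<bullet> x < b"
    proof (rule ccontr)
      assume "\<not> ?thesis"
      then have tight: "b \<le> c \<bullet> ?I L" if "(c, b) \<in> C" for c b
        using that L by force
      have "e \<in> L" if "e \<in> M \<inter> N" for e
        using tight[of "axis e 1" 1] that by (auto simp: C_def inner_axis' split: if_splits)
      moreover have "e \<notin> L" if "e \<notin> M \<union> N" for e
        using tight[of "- axis e 1" 0] that by (auto simp: C_def inner_axis' split: if_splits)
      moreover have cover: "e \<in> L \<or> f \<in> L" if "e \<in> M - N" "f \<in> N - M" "e \<inter> f \<noteq> {}" for e f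
        using tight[of "axis e 1 + axis f 1" 1] that
        by (fastforce simp: C_def inner_axis' inner_add_left split: if_splits)
      \<comment> \<open>\<open>T\<close> collects the edges of the symmetric difference on which
        \<open>L\<close> sides with \<open>M\<close>. Of two incident edges, one from each matching,
        \<open>L\<close> contains exactly one, so \<open>T\<close> is closed under incidence;
        \<open>T\<close> empty means \<open>L = N\<close>, and \<open>T\<close> everything means
        \<open>L = M\<close>.\<close>
      define T where "T = {e \<in> sym_diff M N. e \<in> L \<longleftrightarrow> e \<in> M}"
      have closed: "e \<in> T \<longleftrightarrow> f \<in> T"
        if ef: "e \<in> M - N" "f \<in> N - M" "e \<inter> f \<noteq> {}" for e f
      proof -
        obtain v where "v \<in> e" "v \<in> f" using ef by blast
        then have "\<not> (e \<in> L \<and> f \<in> L)"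
          using ef matching_edge_eq[OF L(2)] by blast
        then show ?thesis using cover[OF ef] ef by (auto simp: T_def)
      qed
      have "f \<in> T" if ef: "e \<in> T" "f \<in> sym_diff M N" "e \<inter> f \<noteq> {}" for e f
      proof -
        obtain v where v: "v \<in> e" "v \<in> f" using ef by blast
        have "e \<in> sym_diff M N" using ef by (simp add: T_def)
        then show ?thesis
          using ef v closed[of e f] closed[of f e] matching_edge_eq[OF M, of e f v]
            matching_edge_eq[OF N, of e f v] by blast
      qed
      then have "T = {} \<or> T = sym_diff M N"
        using edge_connectedD[OF conn, of T] unfolding T_def by blast
      ultimately have "L = N \<or> L = M"
        unfolding T_def by blast
      with L show False by blast
    qed
  qed
  then show ?thesis
    by (simp add: matching_polytope_def segment_convex_hull)
qed

lemma edge_connected_empty [simp]: "edge_connected {}"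
  by (simp add: edge_connected_def)

lemma incidence_vector_in_matching_polytope:
  "matching G M \<Longrightarrow> incidence_vector M \<in> matching_polytope G"
  by (simp add: matching_polytope_def hull_inc)

text \<open>The face lemma with \<open>N = M\<close> has the empty symmetric difference, and its
  segment degenerates to a single point.\<close>

lemma extreme_point_of_matching_polytope_iff:
  "x extreme_point_of matching_polytope G \<longleftrightarrow> x \<in> incidence_vector ` {M. matching G M}"
proof
  assume "x extreme_point_of matching_polytope G"
  then show "x \<in> incidence_vector ` {M. matching G M}"
    unfolding matching_polytope_def by (rule extreme_point_of_convex_hull)
next
  assume "x \<in> incidence_vector ` {M. matching G M}"
  then obtain M where "x = incidence_vector M" "matching G M" by blast
  then show "x extreme_point_of matching_polytope G"
    using segment_face_of_matching_polytope[of G M M] by (simp add: face_of_singleton)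
qed

lemma edge_connected_if_segment_face:
  fixes G :: "'v::finite graph"
  assumes M: "matching G M" and N: "matching G N"
    and face: "closed_segment (incidence_vector M) (incidence_vector N) face_of matching_polytope G"
  shows "edge_connected (sym_diff M N)"
proof (unfold edge_connected_def, intro allI impI, rule ccontr)
  fix T assume T: "T \<subseteq> sym_diff M N" "T \<noteq> {}" "T \<noteq> sym_diff M N"
    and closed: "\<forall>e\<in>T. \<forall>f\<in>sym_diff M N. e \<inter> f \<noteq> {} \<longrightarrow> f \<in> T"
  \<comment> \<open>Exchanging \<open>T\<close> between \<open>M\<close> and \<open>N\<close> yields two other matchings with the same midpoint.\<close>
  define K L where "K = sym_diff M T" and "L = sym_diff N T"
  have K: "matching G K"
    unfolding K_def using matching_exchange[OF M N T(1)] closed by blast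
  have "T \<subseteq> sym_diff N M" using T(1) by blast
  then have L: "matching G L"
    unfolding L_def using matching_exchange[OF N M, of T] closed by blast
  \<comment> \<open>\<open>K\<close> differs from \<open>M\<close> because \<open>T\<close> is
    nonempty, from \<open>N\<close> because \<open>T\<close> is a proper part, and from
    \<open>L\<close> because \<open>M\<close> and \<open>N\<close> differ.\<close>
  have "K \<noteq> M" "K \<noteq> N" "K \<noteq> L"
    using T by (auto simp: K_def L_def)
  have "incidence_vector K + incidence_vector L = (incidence_vector M + incidence_vector N :: real ^ ('v set))"
    using T(1) by (auto simp: vec_eq_iff K_def L_def)
  then have mid: "midpoint (incidence_vector K) (incidence_vector L) =
      (midpoint (incidence_vector M) (incidence_vector N) :: real ^ ('v set))"
    by (simp add: midpoint_def)
  have "midpoint (incidence_vector M) (incidence_vector N) \<in>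
      closed_segment (incidence_vector M) (incidence_vector N :: real ^ ('v set))"
    by simp
  moreover have "midpoint (incidence_vector M) (incidence_vector N) \<in>
      open_segment (incidence_vector K) (incidence_vector L :: real ^ ('v set))"
    using \<open>K \<noteq> L\<close> by (simp flip: mid)
  \<comment> \<open>A face that meets the open segment from \<open>K\<close> to \<open>L\<close>
    contains both of its ends.\<close>
  ultimately have "incidence_vector K \<in> closed_segment (incidence_vector M) (incidence_vector N)"
    using face_ofD[OF face] incidence_vector_in_matching_polytope[OF K]
      incidence_vector_in_matching_polytope[OF L] by blast
  then show False
    using incidence_vector_in_segment \<open>K \<noteq> M\<close> \<open>K \<noteq> N\<close> by blast
qed

lemma segment_edge_of_matching_polytope_iff:
  assumes "matching G M" "matching G N"
  shows "closed_segment (incidence_vector M) (incidence_vector N) edge_of matching_polytope G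
     \<longleftrightarrow> M \<noteq> N \<and> edge_connected (sym_diff M N)"
proof -
  have "aff_dim (closed_segment (incidence_vector M) (incidence_vector N)) = (if M = N then 0 else 1)"
    by (simp add: segment_convex_hull aff_dim_convex_hull)
  then show ?thesis
    using segment_face_of_matching_polytope[OF assms] edge_connected_if_segment_face[OF assms]
    by (auto simp: edge_of_def)
qed

section \<open>The degree as a number of connected exchange sets\<close>

lemma vertex_degree_skeleton:
  fixes G :: "'v::finite graph"
  assumes M: "matching G M"
  shows "vertex_degree (skeleton (matching_polytope G)) (incidence_vector M)
     = card {S. S \<noteq> {} \<and> matching G (sym_diff M S) \<and> edge_connected S}"
proof -
  let ?I = "incidence_vector :: 'v set set \<Rightarrow> real ^ ('v set)"
  let ?A = "{S. S \<noteq> {} \<and> matching G (sym_diff M S) \<and> edge_connected S}"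
  \<comment> \<open>Since \<open>S\<close> and \<open>sym_diff M S\<close> determine each other,
    neighbours of \<open>M\<close> can be indexed by the sets exchanged.\<close>
  have sd: "sym_diff M (sym_diff M S) = S" for S by blast
  have "{e \<in> edges (skeleton (matching_polytope G)). ?I M \<in> e} = (\<lambda>S. {?I M, ?I (sym_diff M S)}) ` ?A"
    (is "?L = ?R")
  proof
    show "?L \<subseteq> ?R"
    proof
      fix e assume "e \<in> ?L"
      then obtain N where N: "e = {?I M, ?I N}" "matching G N"
        "closed_segment (?I M) (?I N) edge_of matching_polytope G"
        unfolding skeleton_def extreme_point_of_matching_polytope_iff
        by (auto; metis insert_commute closed_segment_commute)
      then have "M \<noteq> N \<and> edge_connected (sym_diff M N)"
        using segment_edge_of_matching_polytope_iff[OF M N(2)] by blast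
      then have "sym_diff M N \<in> ?A" using N(2) by (auto simp: sd)
      then show "e \<in> ?R" using N(1) by (rule_tac image_eqI[of _ _ "sym_diff M N"]) (simp_all add: sd)
    qed
    show "?R \<subseteq> ?L"
    proof
      fix e assume "e \<in> ?R"
      then obtain S where S: "S \<in> ?A" "e = {?I M, ?I (sym_diff M S)}" by blast
      then have "closed_segment (?I M) (?I (sym_diff M S)) edge_of matching_polytope G"
        using segment_edge_of_matching_polytope_iff[OF M, of "sym_diff M S"] sd[of S] by auto
      then show "e \<in> ?L"
        using S M by (auto simp: skeleton_def extreme_point_of_matching_polytope_iff)
    qed
  qed
  moreover have "inj_on (\<lambda>S. {?I M, ?I (sym_diff M S)}) ?A"
    by (rule inj_onI) (auto simp: doubleton_eq_iff)
  ultimately show ?thesis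
    by (simp add: vertex_degree_def card_image)
qed

section \<open>Alternating paths and cycles\<close>

lemma length_walk_edges [simp]: "length (walk_edges vs) = length vs - 1"
  by (simp add: walk_edges_def)

lemma nth_walk_edges [simp]: "Suc i < length vs \<Longrightarrow> walk_edges vs ! i = {vs ! i, vs ! Suc i}"
  by (simp add: walk_edges_def nth_tl)

lemma set_walk_edges: "set (walk_edges vs) = {{vs ! i, vs ! Suc i} | i. Suc i < length vs}"
proof -
  have "set (walk_edges vs) = (!) (walk_edges vs) ` {i. Suc i < length vs}"
    by (auto simp: set_conv_nth image_def less_diff_conv simp del: nth_walk_edges)
  also have "\<dots> = (\<lambda>i. {vs ! i, vs ! Suc i}) ` {i. Suc i < length vs}"
    by (rule image_cong) auto
  finally show ?thesis by blast
qed

lemma walk_edges_Cons_Cons [simp]: "walk_edges (u # v # vs) = {u, v} # walk_edges (v # vs)"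
  by (simp add: walk_edges_def)

text \<open>Reversal transfers each statement about the first end of a path to its last end.\<close>

lemma walk_edges_rev: "walk_edges (rev vs) = rev (walk_edges vs)"
  by (rule nth_equalityI) (auto simp: rev_nth Suc_diff_Suc insert_commute)

lemma Union_walk_edges:
  assumes "2 \<le> length vs"
  shows "\<Union> (set (walk_edges vs)) = set vs"
proof
  show "\<Union> (set (walk_edges vs)) \<subseteq> set vs"
    by (auto simp: set_walk_edges)
  show "set vs \<subseteq> \<Union> (set (walk_edges vs))"
  proof
    fix v assume "v \<in> set vs"
    then obtain i where i: "i < length vs" "v = vs ! i" by (auto simp: in_set_conv_nth)
    show "v \<in> \<Union> (set (walk_edges vs))"
    proof (cases "Suc i < length vs")
      case True
      then show ?thesis using i by (auto simp: set_walk_edges)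
    next
      case False
      then obtain j where "i = Suc j" using i assms by (cases i) auto
      then show ?thesis using i by (auto simp: set_walk_edges)
    qed
  qed
qed

lemma hd_walk_edges: "2 \<le> length vs \<Longrightarrow> hd (walk_edges vs) = {vs ! 0, vs ! 1}"
  by (subst hd_conv_nth) (auto simp flip: length_greater_0_conv)

lemma hd_in_hd_walk_edges: "2 \<le> length vs \<Longrightarrow> hd vs \<in> hd (walk_edges vs)"
  by (auto simp: hd_walk_edges hd_conv_nth simp flip: length_greater_0_conv)

lemma last_in_last_walk_edges: "2 \<le> length vs \<Longrightarrow> last vs \<in> last (walk_edges vs)"
  using hd_in_hd_walk_edges[of "rev vs"] by (simp add: walk_edges_rev hd_rev)

lemma walk_edge_at_hd:
  assumes "distinct vs" "2 \<le> length vs" "e \<in> set (walk_edges vs)" "hd vs \<in> e"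
  shows "e = hd (walk_edges vs)"
proof -
  obtain j where j: "Suc j < length vs" "e = {vs ! j, vs ! Suc j}"
    using assms(3) unfolding set_walk_edges by blast
  have "hd vs = vs ! 0" using assms(2) by (subst hd_conv_nth) auto
  then have "vs ! 0 = vs ! j \<or> vs ! 0 = vs ! Suc j"
    using assms(4) j(2) by simp
  then have "j = 0"
    using j(1) nth_eq_iff_index_eq[OF assms(1), of 0 j] nth_eq_iff_index_eq[OF assms(1), of 0 "Suc j"]
    by linarith
  then show ?thesis
    using j(2) assms(2) by (simp add: hd_walk_edges)
qed

lemma walk_edge_at_last:
  assumes "distinct vs" "2 \<le> length vs" "e \<in> set (walk_edges vs)" "last vs \<in> e"
  shows "e = last (walk_edges vs)"
  using walk_edge_at_hd[of "rev vs" e] assms by (simp add: walk_edges_rev hd_rev)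

lemma walk_edge_at_inner:
  assumes "distinct vs" "Suc (Suc j) < length vs" "e \<in> set (walk_edges vs)" "vs ! Suc j \<in> e"
  shows "e = {vs ! j, vs ! Suc j} \<or> e = {vs ! Suc j, vs ! Suc (Suc j)}"
proof -
  obtain k where k: "Suc k < length vs" "e = {vs ! k, vs ! Suc k}"
    using assms(3) unfolding set_walk_edges by blast
  then have "vs ! Suc j = vs ! k \<or> vs ! Suc j = vs ! Suc k"
    using assms(4) by blast
  then have "Suc j = k \<or> j = k"
    using k(1) assms(2) nth_eq_iff_index_eq[OF assms(1), of "Suc j" k]
      nth_eq_iff_index_eq[OF assms(1), of "Suc j" "Suc k"] by linarith
  then show ?thesis using k(2) by blast
qed

text \<open>Inner vertices are written \<open>vs ! Suc j\<close>, so that both neighbours have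
  explicit indices, \<open>j\<close> and \<open>Suc (Suc j)\<close>.\<close>

lemma path_vertex_cases:
  assumes "v \<in> set vs"
  obtains "v = hd vs" | "v = last vs" | j where "Suc (Suc j) < length vs" "v = vs ! Suc j"
proof -
  obtain i where i: "i < length vs" "v = vs ! i" using assms by (auto simp: in_set_conv_nth)
  then have ne: "vs \<noteq> []" by auto
  consider "i = 0" | "Suc i = length vs" | j where "i = Suc j" "Suc i < length vs"
    using i(1) Suc_lessI[OF i(1)] not0_implies_Suc[of i] by blast
  then show thesis
  proof cases
    case 1
    then show thesis using i that(1) ne by (simp add: hd_conv_nth)
  next
    case 2
    then have "i = length vs - 1" by simp
    then show thesis using i that(2) ne by (simp add: last_conv_nth)
  next
    case (3 j)
    then show thesis using i that(3) by simp
  qed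
qed

section \<open>Cyclic indexing of cycle edges\<close>

lemma length_cycle_edges [simp]: "length (cycle_edges vs) = length vs"
  by (simp add: cycle_edges_def)

lemma nth_cycle_edges [simp]:
  "i < length vs \<Longrightarrow> cycle_edges vs ! i = {vs ! i, vs ! (Suc i mod length vs)}"
  by (auto simp: cycle_edges_def nth_append mod_Suc hd_conv_nth
      simp flip: length_greater_0_conv)

lemma set_cycle_edges:
  "set (cycle_edges vs) = {{vs ! i, vs ! (Suc i mod length vs)} | i. i < length vs}"
proof -
  have "set (cycle_edges vs) = (!) (cycle_edges vs) ` {i. i < length vs}"
    by (auto simp: set_conv_nth image_def simp del: nth_cycle_edges)
  also have "\<dots> = (\<lambda>i. {vs ! i, vs ! (Suc i mod length vs)}) ` {i. i < length vs}"
    by (rule image_cong) auto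
  finally show ?thesis by blast
qed

lemma Suc_mod_inj: "i < n \<Longrightarrow> j < n \<Longrightarrow> Suc i mod n = Suc j mod n \<longleftrightarrow> i = j"
  by (auto simp: mod_Suc split: if_splits)

lemma Suc_mod_surj:
  assumes "i < (n::nat)"
  obtains j where "j < n" "i = Suc j mod n"
proof (cases i)
  case 0
  then show ?thesis using assms that[of "n - 1"] by simp
next
  case (Suc j)
  then show ?thesis using assms that[of j] by simp
qed

text \<open>In this form the vertex is visibly the common end of the cycle edges with indices
  \<open>j\<close> and \<open>Suc j mod length vs\<close>; no cyclic predecessor has to be
  computed.\<close>

lemma cycle_vertexE:
  assumes "v \<in> set vs"
  obtains j where "j < length vs" "v = vs ! (Suc j mod length vs)"
proof -
  obtain i where i: "i < length vs" "v = vs ! i" using assms by (auto simp: in_set_conv_nth)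
  obtain j where "j < length vs" "i = Suc j mod length vs" using i(1) by (rule Suc_mod_surj)
  then show thesis using i that by simp
qed

lemma cycle_edge_at_vertex:
  assumes "distinct vs" "j < length vs" "e \<in> set (cycle_edges vs)" "vs ! (Suc j mod length vs) \<in> e"
  shows "e = cycle_edges vs ! j \<or> e = cycle_edges vs ! (Suc j mod length vs)"
proof -
  let ?n = "length vs"
  obtain k where k: "k < ?n" "e = cycle_edges vs ! k"
    using assms(3) unfolding in_set_conv_nth length_cycle_edges by blast
  have lt: "Suc j mod ?n < ?n" "Suc k mod ?n < ?n"
    using k(1) by (intro mod_less_divisor; linarith)+
  have "Suc j mod ?n = k \<or> Suc j mod ?n = Suc k mod ?n"
    using assms(4) k lt nth_eq_iff_index_eq[OF assms(1)] by simp
  then show ?thesis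
    using assms(2) k Suc_mod_inj[of j ?n k] by metis
qed

lemma Union_cycle_edges: "\<Union> (set (cycle_edges vs)) = set vs"
proof
  show "\<Union> (set (cycle_edges vs)) \<subseteq> set vs"
  proof
    fix v assume "v \<in> \<Union> (set (cycle_edges vs))"
    then obtain i where "i < length vs" "v = vs ! i \<or> v = vs ! (Suc i mod length vs)"
      by (auto simp: set_cycle_edges)
    moreover from this(1) have "Suc i mod length vs < length vs"
      by (intro mod_less_divisor) linarith
    ultimately show "v \<in> set vs" by auto
  qed
  show "set vs \<subseteq> \<Union> (set (cycle_edges vs))"
  proof
    fix v assume "v \<in> set vs"
    then obtain i where "i < length vs" "v = vs ! i" by (auto simp: in_set_conv_nth)
    then show "v \<in> \<Union> (set (cycle_edges vs))" unfolding set_cycle_edges by blast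
  qed
qed

text \<open>Membership in a closed part \<open>T\<close> passes between list neighbours in both
  directions, so one member of \<open>T\<close> brings in the whole list.\<close>

lemma edge_connected_set_list:
  assumes adj: "\<And>i. Suc i < length es \<Longrightarrow> es ! i \<inter> es ! Suc i \<noteq> {}"
  shows "edge_connected (set es)"
  unfolding edge_connected_def
proof (intro allI impI)
  fix T assume T: "T \<subseteq> set es" "T \<noteq> {}" and closed: "\<forall>e\<in>T. \<forall>f\<in>set es. e \<inter> f \<noteq> {} \<longrightarrow> f \<in> T"
  have step: "es ! i \<in> T \<longleftrightarrow> es ! Suc i \<in> T" if "Suc i < length es" for i
  proof -
    have "es ! i \<in> set es" "es ! Suc i \<in> set es" "es ! Suc i \<inter> es ! i \<noteq> {}"
      using adj[OF that] that by (auto simp: Int_commute)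
    then show ?thesis using closed adj[OF that] by blast
  qed
  then have "es ! i \<in> T \<longleftrightarrow> es ! 0 \<in> T" if "i < length es" for i
    using that by (induction i) auto
  then have "e \<in> T \<longleftrightarrow> es ! 0 \<in> T" if "e \<in> set es" for e
    using that by (auto simp: in_set_conv_nth)
  then show "T = set es"
    using T by blast
qed

lemma edge_connected_walk: "edge_connected (set (walk_edges vs))"
  by (rule edge_connected_set_list) auto

lemma edge_connected_cycle: "edge_connected (set (cycle_edges vs))"
  unfolding cycle_edges_def by (rule edge_connected_walk)

section \<open>Exchanging along good paths and cycles\<close>

text \<open>The entering edges \<open>S - M\<close> must not meet each other, and each old edge that
  meets one of them must leave. Two old edges never meet.\<close>

lemma matching_sym_diffI:
  assumes M: "matching G M" and S: "S \<subseteq> edges G"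
    and unique: "\<And>e f v. e \<in> S - M \<Longrightarrow> f \<in> S - M \<Longrightarrow> v \<in> e \<Longrightarrow> v \<in> f \<Longrightarrow> f = e"
    and cover: "\<And>e f v. e \<in> S - M \<Longrightarrow> f \<in> M \<Longrightarrow> v \<in> e \<Longrightarrow> v \<in> f \<Longrightarrow> f \<in> S"
  shows "matching G (sym_diff M S)"
proof (rule matchingI)
  show "sym_diff M S \<subseteq> edges G" using M S by (auto simp: matching_def)
next
  fix e f v assume ef: "e \<in> sym_diff M S" "f \<in> sym_diff M S" and v: "v \<in> e" "v \<in> f"
  show "e = f"
  proof (cases "e \<in> M"; cases "f \<in> M")
    assume "e \<in> M" "f \<in> M"
    then show ?thesis using matching_edge_eq[OF M] v by blast
  qed (use ef v unique[of f e v] cover[of e f v] cover[of f e v] in auto)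
qed

text \<open>The three kinds merge into one condition at each end. A pendant edge in \<open>M\<close>
  saturates its pendant vertex, so the two requirements on an oc-path necessarily concern opposite
  ends.\<close>

lemma good_path_iff:
  "oo_path G M vs \<or> cc_path G M vs \<or> oc_path G M vs \<longleftrightarrow> alternating_path G M vs \<and>
     (hd (walk_edges vs) \<in> M \<or> \<not> saturated M (hd vs)) \<and>
     (last (walk_edges vs) \<in> M \<or> \<not> saturated M (last vs))"
proof (cases "alternating_path G M vs")
  case True
  then have "2 \<le> length vs" by (simp add: alternating_path_def is_path_def)
  then have "hd vs \<in> hd (walk_edges vs)" "last vs \<in> last (walk_edges vs)"
    by (simp_all add: hd_in_hd_walk_edges last_in_last_walk_edges)
  then show ?thesis
    by (auto simp: oo_path_def cc_path_def oc_path_def saturated_def)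
qed (simp add: oo_path_def cc_path_def oc_path_def)

lemma matching_sym_diff_good_path:
  assumes M: "matching G M" and alt: "alternating_path G M vs"
    and hd: "hd (walk_edges vs) \<in> M \<or> \<not> saturated M (hd vs)"
    and last: "last (walk_edges vs) \<in> M \<or> \<not> saturated M (last vs)"
  shows "matching G (sym_diff M (set (walk_edges vs)))"
proof -
  let ?S = "set (walk_edges vs)"
  have vs: "distinct vs" "2 \<le> length vs" "?S \<subseteq> edges G"
    using alt by (auto simp: alternating_path_def is_path_def)
  have step: "({vs ! j, vs ! Suc j} \<in> M) \<noteq> ({vs ! Suc j, vs ! Suc (Suc j)} \<in> M)"
    if "Suc (Suc j) < length vs" for j
    using alt that unfolding alternating_path_def successively_conv_nth
    by (auto dest!: spec[of _ j])
  \<comment> \<open>This covers both conditions for an exchange. At an end, \<open>e\<close> is the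
    only path edge, and the end condition excludes edges of \<open>M\<close>; at an inner vertex,
    alternation makes the other path edge the unique edge of \<open>M\<close> there.\<close>
  have local: "(f \<in> ?S - M \<longrightarrow> f = e) \<and> (f \<in> M \<longrightarrow> f \<in> ?S)"
    if e: "e \<in> ?S - M" and v: "v \<in> e" "v \<in> f" for e f v
  proof -
    have "v \<in> set vs" using e v Union_walk_edges[OF vs(2)] by blast
    then show ?thesis
    proof (cases rule: path_vertex_cases)
      case 1
      then have "e = hd (walk_edges vs)" using walk_edge_at_hd vs e v by blast
      then show ?thesis using 1 walk_edge_at_hd[OF vs(1,2)] hd e v by (auto simp: saturated_def)
    next
      case 2
      then have "e = last (walk_edges vs)" using walk_edge_at_last vs e v by blast
      then show ?thesis using 2 walk_edge_at_last[OF vs(1,2)] last e v by (auto simp: saturated_def)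
    next
      case (3 j)
      let ?a = "{vs ! j, vs ! Suc j}" and ?b = "{vs ! Suc j, vs ! Suc (Suc j)}"
      have "?a \<in> ?S" "?b \<in> ?S" using 3 by (auto simp: set_walk_edges)
      moreover have "e = ?a \<or> e = ?b" "f \<in> ?S \<Longrightarrow> f = ?a \<or> f = ?b"
        using walk_edge_at_inner[OF vs(1) 3(1)] e v 3 by blast+
      moreover have "f \<in> M \<Longrightarrow> ?a \<in> M \<Longrightarrow> f = ?a" "f \<in> M \<Longrightarrow> ?b \<in> M \<Longrightarrow> f = ?b"
        using matching_edge_eq[OF M, of f _ v] v 3 by blast+
      ultimately show ?thesis using step[OF 3(1)] e by auto
    qed
  qed
  show ?thesis
    by (rule matching_sym_diffI[OF M vs(3)]) (use local in blast)+
qed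

lemma alternating_cycle_step:
  assumes "alternating_cycle G M vs" "j < length vs"
  shows "(cycle_edges vs ! j \<in> M) \<noteq> (cycle_edges vs ! (Suc j mod length vs) \<in> M)"
proof -
  let ?es = "cycle_edges vs"
  have "(?es @ [hd ?es]) ! Suc j = ?es ! (Suc j mod length vs)"
    using assms(2) by (auto simp: nth_append mod_Suc hd_conv_nth simp flip: length_greater_0_conv
        simp del: nth_cycle_edges)
  moreover have "(?es @ [hd ?es]) ! j = ?es ! j"
    using assms(2) by (simp add: nth_append del: nth_cycle_edges)
  ultimately show ?thesis
    using assms unfolding alternating_cycle_def successively_conv_nth
    by (auto dest!: spec[of _ j] simp del: nth_cycle_edges)
qed

text \<open>Every vertex lies on two consecutive cycle edges, exactly one of them in
  \<open>M\<close>, so the argument for inner path vertices applies everywhere.\<close>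

lemma matching_sym_diff_good_cycle:
  assumes M: "matching G M" and alt: "alternating_cycle G M vs"
  shows "matching G (sym_diff M (set (cycle_edges vs)))"
proof -
  let ?S = "set (cycle_edges vs)" and ?n = "length vs"
  have vs: "distinct vs" "3 \<le> ?n" "?S \<subseteq> edges G"
    using alt by (auto simp: alternating_cycle_def is_cycle_def)
  have local: "(f \<in> ?S - M \<longrightarrow> f = e) \<and> (f \<in> M \<longrightarrow> f \<in> ?S)"
    if e: "e \<in> ?S - M" and v: "v \<in> e" "v \<in> f" for e f v
  proof -
    have "v \<in> set vs" using e v Union_cycle_edges[of vs] by blast
    then obtain j where j: "j < ?n" "v = vs ! (Suc j mod ?n)" by (rule cycle_vertexE)
    define a b where "a = cycle_edges vs ! j" and "b = cycle_edges vs ! (Suc j mod ?n)"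
    have lt: "Suc j mod ?n < ?n" using vs by (intro mod_less_divisor) linarith
    have "a \<in> ?S" "b \<in> ?S" using j lt by (auto simp: a_def b_def simp del: nth_cycle_edges)
    moreover have "v \<in> a" "v \<in> b" using j lt by (auto simp: a_def b_def)
    moreover have "e = a \<or> e = b" "f \<in> ?S \<Longrightarrow> f = a \<or> f = b"
      using cycle_edge_at_vertex[OF vs(1) j(1)] e v j(2) unfolding a_def b_def by blast+
    moreover have "f \<in> M \<Longrightarrow> a \<in> M \<Longrightarrow> f = a" "f \<in> M \<Longrightarrow> b \<in> M \<Longrightarrow> f = b"
      using matching_edge_eq[OF M, of f _ v] v calculation by blast+
    ultimately show ?thesis
      using alternating_cycle_step[OF alt j(1)] e unfolding a_def[symmetric] b_def[symmetric] by auto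
  qed
  show ?thesis
    by (rule matching_sym_diffI[OF M vs(3)]) (use local in blast)+
qed

text \<open>The first vertex of a path lies on one edge of it, whereas every vertex of a cycle lies on two.\<close>

lemma good_paths_good_cycles_disjoint: "good_paths G M \<inter> good_cycles G M = {}"
proof (rule ccontr)
  assume "\<not> ?thesis"
  then obtain us vs where us: "alternating_path G M us" and vs: "alternating_cycle G M vs"
    and eq: "set (walk_edges us) = set (cycle_edges vs)"
    unfolding good_paths_def good_cycles_def good_path_iff by auto
  let ?n = "length vs"
  have u: "distinct us" "2 \<le> length us"
    using us by (auto simp: alternating_path_def is_path_def)
  then have "hd us \<in> set us" by (intro hd_in_set) auto
  then have "hd us \<in> set vs"
    using Union_walk_edges[OF u(2)] Union_cycle_edges[of vs] eq by simp
  then obtain j where j: "j < ?n" "hd us = vs ! (Suc j mod ?n)" by (rule cycle_vertexE)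
  have lt: "Suc j mod ?n < ?n" using j by (intro mod_less_divisor) linarith
  have "e = hd (walk_edges us)" if "e \<in> set (cycle_edges vs)" "hd us \<in> e" for e
    using walk_edge_at_hd[OF u] that eq by blast
  moreover have "cycle_edges vs ! j \<in> set (cycle_edges vs)"
    "cycle_edges vs ! (Suc j mod ?n) \<in> set (cycle_edges vs)"
    using j lt by (auto simp del: nth_cycle_edges)
  moreover have "hd us \<in> cycle_edges vs ! j" "hd us \<in> cycle_edges vs ! (Suc j mod ?n)"
    using j lt by auto
  ultimately have "cycle_edges vs ! j = cycle_edges vs ! (Suc j mod ?n)" by metis
  then show False using alternating_cycle_step[OF vs j(1)] by metis
qed

section \<open>Connected exchange sets are good paths or cycles\<close>

text \<open>Incident edges cannot both lie in \<open>M\<close>; if both were outside, both would lie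
  in the matching \<open>sym_diff M S\<close>.\<close>

lemma sym_diff_matching_alternates:
  assumes "matching G M" "matching G (sym_diff M S)"
    and "e \<in> S" "f \<in> S" "e \<noteq> f" "v \<in> e" "v \<in> f"
  shows "(e \<in> M) \<noteq> (f \<in> M)"
  using assms(3-) matching_edge_eq[OF assms(1), of e f v] matching_edge_eq[OF assms(2), of e f v]
  by auto

text \<open>Three edges at one vertex would have to differ pairwise in membership in
  \<open>M\<close>, which takes only two values.\<close>

lemma sym_diff_matching_at_most_two:
  assumes "matching G M" "matching G (sym_diff M S)"
    and "e \<in> S" "f \<in> S" "e \<noteq> f" "v \<in> e" "v \<in> f" "g \<in> S" "v \<in> g"
  shows "g = e \<or> g = f"
  using sym_diff_matching_alternates[OF assms(1,2), of e f v]
    sym_diff_matching_alternates[OF assms(1,2), of e g v]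
    sym_diff_matching_alternates[OF assms(1,2), of f g v] assms(3-)
  by (cases "g = e"; cases "g = f") simp_all

lemma inner_vertex_edge_in_walk:
  assumes M: "matching G M" and N: "matching G (sym_diff M S)"
    and vs: "distinct vs" "set (walk_edges vs) \<subseteq> S" "Suc (Suc j) < length vs"
    and g: "g \<in> S" "vs ! Suc j \<in> g"
  shows "g \<in> set (walk_edges vs)"
proof -
  let ?a = "{vs ! j, vs ! Suc j}" and ?b = "{vs ! Suc j, vs ! Suc (Suc j)}"
  have ab: "?a \<in> set (walk_edges vs)" "?b \<in> set (walk_edges vs)"
    using vs(3) by (auto simp: set_walk_edges)
  have "vs ! j \<noteq> vs ! Suc (Suc j)" "vs ! j \<noteq> vs ! Suc j"
    using vs by (simp_all add: nth_eq_iff_index_eq)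
  then have "?a \<noteq> ?b" by (auto simp: doubleton_eq_iff)
  then have "g = ?a \<or> g = ?b"
    using sym_diff_matching_at_most_two[OF M N, of ?a ?b "vs ! Suc j" g] ab vs(2) g by auto
  then show ?thesis using ab by auto
qed

text \<open>By maximality the other end of \<open>g\<close> is on the path. It is not an inner
  vertex, whose edges of \<open>S\<close> are all on the path already, so it is the last one; on a
  path with two vertices, \<open>g\<close> would be the path edge itself.\<close>

lemma longest_path_end:
  assumes M: "matching G M" and N: "matching G (sym_diff M S)"
    and card: "\<And>e. e \<in> S \<Longrightarrow> card e = 2"
    and vs: "distinct vs" "2 \<le> length vs" "set (walk_edges vs) \<subseteq> S"
    and max: "\<And>w. w \<notin> set vs \<Longrightarrow> {w, hd vs} \<notin> S"
    and g: "g \<in> S" "hd vs \<in> g" "g \<notin> set (walk_edges vs)"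
  shows "3 \<le> length vs \<and> g = {last vs, hd vs}"
proof -
  obtain w where w: "g = {w, hd vs}" "w \<noteq> hd vs"
    using card[OF g(1)] g(2) by (auto simp: card_2_iff)
  then have "w \<in> set vs" using max g(1) by blast
  then have "w = last vs"
    using w g inner_vertex_edge_in_walk[OF M N vs(1,3)] by (cases rule: path_vertex_cases) auto
  moreover have "length vs \<noteq> 2"
  proof
    assume "length vs = 2"
    then obtain a b where "vs = [a, b]" by (auto simp: length_Suc_conv numeral_2_eq_2)
    then show False using w g \<open>w = last vs\<close> by (auto simp: walk_edges_def insert_commute)
  qed
  ultimately show ?thesis using vs(2) w by auto
qed

lemma ex_longest_path:
  fixes S :: "'v::finite set set"
  assumes S: "S \<noteq> {}" "\<And>e. e \<in> S \<Longrightarrow> card e = 2"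
  obtains vs where "distinct vs" "2 \<le> length vs" "set (walk_edges vs) \<subseteq> S"
    "\<And>w. w \<notin> set vs \<Longrightarrow> {w, hd vs} \<notin> S" "\<And>w. w \<notin> set vs \<Longrightarrow> {w, last vs} \<notin> S"
proof -
  let ?P = "\<lambda>vs::'v list. distinct vs \<and> 2 \<le> length vs \<and> set (walk_edges vs) \<subseteq> S"
  obtain a b where "{a, b} \<in> S" "a \<noteq> b"
    using S by (metis card_2_iff ex_in_conv)
  then have "?P [a, b]" by (simp add: walk_edges_def)
  moreover have "length vs < Suc CARD('v)" if "?P vs" for vs :: "'v list"
    using that card_mono[of UNIV "set vs"] by (simp add: distinct_card)
  ultimately obtain vs where vs: "?P vs" and max: "\<And>us. ?P us \<Longrightarrow> length us \<le> length vs"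
    using ex_has_greatest_nat[of ?P "[a, b]" length "Suc CARD('v)"] by blast
  \<comment> \<open>Stated for every path of maximal length, so that it applies to both
    \<open>vs\<close> and \<open>rev vs\<close>.\<close>
  have ext: "{w, hd us} \<notin> S" if "w \<notin> set us" "?P us" "length us = length vs" for w us
  proof
    assume "{w, hd us} \<in> S"
    then have "?P (w # us)" using that by (cases us) auto
    then show False using max[of "w # us"] that by simp
  qed
  show ?thesis
  proof (rule that)
    show "{w, last vs} \<notin> S" if "w \<notin> set vs" for w
      using ext[of w "rev vs"] that vs by (simp add: walk_edges_rev hd_rev)
  qed (use vs ext in auto)
qed

lemma alternating_path_if_sym_diff_matching:
  assumes M: "matching G M" and N: "matching G (sym_diff M S)"
    and vs: "is_path G vs" "set (walk_edges vs) \<subseteq> S"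
  shows "alternating_path G M vs"
  unfolding alternating_path_def successively_conv_nth
proof (intro conjI allI impI)
  fix j assume "Suc j < length (walk_edges vs)"
  then have j: "Suc (Suc j) < length vs" by simp
  let ?a = "{vs ! j, vs ! Suc j}" and ?b = "{vs ! Suc j, vs ! Suc (Suc j)}"
  have "?a \<in> set (walk_edges vs)" "?b \<in> set (walk_edges vs)"
    using j by (auto simp: set_walk_edges)
  then have "?a \<in> S" "?b \<in> S" using vs(2) by blast+
  moreover have "vs ! j \<noteq> vs ! Suc (Suc j)" "vs ! j \<noteq> vs ! Suc j"
    using vs(1) j by (simp_all add: nth_eq_iff_index_eq is_path_def)
  then have "?a \<noteq> ?b" by (auto simp: doubleton_eq_iff)
  ultimately have "(?a \<in> M) \<noteq> (?b \<in> M)"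
    using sym_diff_matching_alternates[OF M N, of ?a ?b "vs ! Suc j"] by auto
  then show "(walk_edges vs ! j \<in> M) \<noteq> (walk_edges vs ! Suc j \<in> M)"
    using j by simp
qed (rule vs(1))

lemma consecutive_cycle_edges_distinct:
  assumes "distinct vs" "3 \<le> length vs" "j < length vs"
  shows "cycle_edges vs ! j \<noteq> cycle_edges vs ! (Suc j mod length vs)"
proof -
  let ?n = "length vs" and ?k = "Suc j mod length vs" and ?l = "Suc (Suc j mod length vs) mod length vs"
  have "?k < ?n" "?l < ?n" using assms by (auto intro!: mod_less_divisor)
  \<comment> \<open>With at least three vertices, the vertex at \<open>j\<close> recurs neither one
    nor two steps later, so it is not on the second edge.\<close>
  moreover have "j \<noteq> ?k" "j \<noteq> ?l"
    using assms by (auto simp: mod_Suc)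
  ultimately show ?thesis
    using assms by (auto simp: doubleton_eq_iff nth_eq_iff_index_eq)
qed

lemma alternating_cycle_if_sym_diff_matching:
  assumes M: "matching G M" and N: "matching G (sym_diff M S)"
    and vs: "is_cycle G vs" "set (cycle_edges vs) \<subseteq> S"
  shows "alternating_cycle G M vs"
  unfolding alternating_cycle_def successively_conv_nth
proof (intro conjI allI impI)
  let ?es = "cycle_edges vs"
  fix j assume "Suc j < length (?es @ [hd ?es])"
  then have j: "j < length vs" by simp
  let ?k = "Suc j mod length vs"
  have d: "distinct vs" "3 \<le> length vs" using vs(1) by (auto simp: is_cycle_def)
  have k: "?k < length vs" using j by (intro mod_less_divisor) linarith
  have "?es ! j \<in> S" "?es ! ?k \<in> S"
    using vs(2) j k nth_mem[of _ ?es] by (auto simp del: nth_cycle_edges)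
  moreover have "vs ! ?k \<in> ?es ! j" "vs ! ?k \<in> ?es ! ?k"
    using j k by auto
  ultimately have "(?es ! j \<in> M) \<noteq> (?es ! ?k \<in> M)"
    using sym_diff_matching_alternates[OF M N] consecutive_cycle_edges_distinct[OF d j] by metis
  moreover have "(?es @ [hd ?es]) ! Suc j = ?es ! ?k"
    using j by (auto simp: nth_append mod_Suc hd_conv_nth simp flip: length_greater_0_conv
        simp del: nth_cycle_edges)
  moreover have "(?es @ [hd ?es]) ! j = ?es ! j"
    using j by (simp add: nth_append del: nth_cycle_edges)
  ultimately show "((?es @ [hd ?es]) ! j \<in> M) \<noteq> ((?es @ [hd ?es]) ! Suc j \<in> M)"
    by metis
qed (rule vs(1))

lemma set_cycle_edges_eq_insert:
  assumes "vs \<noteq> []"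
  shows "set (cycle_edges vs) = insert {last vs, hd vs} (set (walk_edges vs))"
proof -
  have "walk_edges (us @ [w]) = walk_edges us @ [{last us, w}]" if "us \<noteq> []" for us :: "'a list" and w
    using that by (induction us rule: induct_list012) (auto simp: walk_edges_def)
  then show ?thesis using assms by (simp add: cycle_edges_def)
qed

text \<open>The two cycle edges at a vertex already exhaust the edges of \<open>S\<close>
  there.\<close>

lemma cycle_closed_in_sym_diff_matching:
  assumes M: "matching G M" and N: "matching G (sym_diff M S)"
    and vs: "distinct vs" "3 \<le> length vs" "set (cycle_edges vs) \<subseteq> S"
    and g: "g \<in> S" "v \<in> g" "v \<in> set vs"
  shows "g \<in> set (cycle_edges vs)"
proof -
  let ?es = "cycle_edges vs"
  obtain j where j: "j < length vs" "v = vs ! (Suc j mod length vs)"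
    using g(3) by (rule cycle_vertexE)
  let ?k = "Suc j mod length vs"
  have k: "?k < length vs" using j by (intro mod_less_divisor) linarith
  have es: "?es ! j \<in> set ?es" "?es ! ?k \<in> set ?es"
    using j k by (auto simp del: nth_cycle_edges)
  moreover have "v \<in> ?es ! j" "v \<in> ?es ! ?k"
    using j k by auto
  ultimately have "g = ?es ! j \<or> g = ?es ! ?k"
    using sym_diff_matching_at_most_two[OF M N, of "?es ! j" "?es ! ?k" v g] vs(3) g
      consecutive_cycle_edges_distinct[OF vs(1,2) j(1)] by blast
  then show ?thesis using es by metis
qed

text \<open>If \<open>e\<close> enters and some \<open>f\<close> in \<open>M\<close> covers
  \<open>v\<close>, then \<open>f\<close> is not \<open>e\<close> and so lies outside
  \<open>S\<close>. It would survive the exchange and meet \<open>e\<close>.\<close>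

lemma sym_diff_matching_end:
  assumes "matching G (sym_diff M S)" "e \<in> S" "v \<in> e"
    and "\<And>f. f \<in> S \<Longrightarrow> v \<in> f \<Longrightarrow> f = e"
  shows "e \<in> M \<or> \<not> saturated M v"
proof (rule ccontr)
  assume "\<not> ?thesis"
  then obtain f where "e \<notin> M" "f \<in> M" "v \<in> f" by (auto simp: saturated_def)
  then show False
    using assms(2-) matching_edge_eq[OF assms(1), of e f v] by blast
qed

lemma good_if_edge_connected:
  fixes G :: "'v::finite graph"
  assumes G: "finite_simple_graph G" and M: "matching G M" and N: "matching G (sym_diff M S)"
    and S: "S \<noteq> {}" and conn: "edge_connected S"
  shows "S \<in> good_paths G M \<union> good_cycles G M"
proof -
  have SE: "S \<subseteq> edges G" using M N by (auto simp: matching_def)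
  then have card: "\<And>e. e \<in> S \<Longrightarrow> card e = 2" and sub: "\<Union> S \<subseteq> verts G"
    using G by (auto simp: finite_simple_graph_def)
  obtain vs where vs: "distinct vs" "2 \<le> length vs" "set (walk_edges vs) \<subseteq> S"
    and max: "\<And>w. w \<notin> set vs \<Longrightarrow> {w, hd vs} \<notin> S" "\<And>w. w \<notin> set vs \<Longrightarrow> {w, last vs} \<notin> S"
    using ex_longest_path[OF S card] by blast
  let ?W = "set (walk_edges vs)"
  have ne: "vs \<noteq> []" "walk_edges vs \<noteq> []" using vs(2) by (auto simp flip: length_greater_0_conv)
  have verts: "set vs \<subseteq> verts G" using Union_walk_edges[OF vs(2)] vs(3) sub by blast
  show ?thesis
  \<comment> \<open>Either the longest path closes up to a cycle within \<open>S\<close> or it does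
    not. In both cases the edge set found is closed under incidence, and connectedness makes it all
    of \<open>S\<close>. The length bound excludes a single edge, which also joins its two
    ends.\<close>
  proof (cases "3 \<le> length vs \<and> {last vs, hd vs} \<in> S")
    case True
    let ?C = "set (cycle_edges vs)"
    have C: "?C \<subseteq> S" using True vs(3) ne by (simp add: set_cycle_edges_eq_insert)
    have "?C = S"
    proof (rule edge_connectedD[OF conn C])
      fix e f assume "e \<in> ?C" "f \<in> S" "e \<inter> f \<noteq> {}"
      then obtain v where "v \<in> set vs" "v \<in> f" using Union_cycle_edges[of vs] by blast
      then show "f \<in> ?C"
        using cycle_closed_in_sym_diff_matching[OF M N vs(1) _ C \<open>f \<in> S\<close>] True by blast
    qed (use ne in \<open>auto simp: set_cycle_edges_eq_insert\<close>)
    moreover have "is_cycle G vs"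
      using True vs(1) verts C SE by (auto simp: is_cycle_def)
    ultimately show ?thesis
      using alternating_cycle_if_sym_diff_matching[OF M N _ C] by (auto simp: good_cycles_def)
  next
    case False
    have "?W = S"
    proof (rule edge_connectedD[OF conn vs(3)])
      fix e f assume "e \<in> ?W" "f \<in> S" "e \<inter> f \<noteq> {}"
      then obtain v where "v \<in> set vs" "v \<in> f" using Union_walk_edges[OF vs(2)] by blast
      from \<open>v \<in> set vs\<close> show "f \<in> ?W"
      proof (cases rule: path_vertex_cases)
        case 1
        then show ?thesis
          using longest_path_end[OF M N card vs max(1) \<open>f \<in> S\<close>] \<open>f \<in> S\<close> \<open>v \<in> f\<close> False by blast
      next
        case 2
        then show ?thesis
          using longest_path_end[OF M N card, of "rev vs" f] vs max(2) \<open>f \<in> S\<close> \<open>v \<in> f\<close> False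
          by (auto simp: walk_edges_rev hd_rev last_rev insert_commute)
      next
        case (3 j)
        then show ?thesis
          using inner_vertex_edge_in_walk[OF M N vs(1,3)] \<open>f \<in> S\<close> \<open>v \<in> f\<close> by blast
      qed
    qed (use ne in simp)
    have "is_path G vs"
      using vs verts SE by (auto simp: is_path_def)
    moreover have "hd (walk_edges vs) \<in> M \<or> \<not> saturated M (hd vs)"
    proof (rule sym_diff_matching_end[OF N])
      show "hd (walk_edges vs) \<in> S" using vs(3) ne by auto
      show "hd vs \<in> hd (walk_edges vs)" using vs(2) by (rule hd_in_hd_walk_edges)
    qed (use walk_edge_at_hd[OF vs(1,2)] \<open>?W = S\<close> in blast)
    moreover have "last (walk_edges vs) \<in> M \<or> \<not> saturated M (last vs)"
    proof (rule sym_diff_matching_end[OF N])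
      show "last (walk_edges vs) \<in> S" using vs(3) ne by auto
      show "last vs \<in> last (walk_edges vs)" using vs(2) by (rule last_in_last_walk_edges)
    qed (use walk_edge_at_last[OF vs(1,2)] \<open>?W = S\<close> in blast)
    ultimately show ?thesis
      using alternating_path_if_sym_diff_matching[OF M N _ vs(3)] \<open>?W = S\<close>
      unfolding good_paths_def good_path_iff by blast
  qed
qed

lemma good_paths_un_good_cycles:
  fixes G :: "'v::finite graph"
  assumes G: "finite_simple_graph G" and M: "matching G M"
  shows "good_paths G M \<union> good_cycles G M =
    {S. S \<noteq> {} \<and> matching G (sym_diff M S) \<and> edge_connected S}" (is "?L = ?R")
proof
  show "?R \<subseteq> ?L" using good_if_edge_connected[OF G M] by blast
  have "S \<in> ?R" if "S \<in> good_paths G M" for S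
  proof -
    obtain vs where vs: "S = set (walk_edges vs)" "alternating_path G M vs"
      "hd (walk_edges vs) \<in> M \<or> \<not> saturated M (hd vs)"
      "last (walk_edges vs) \<in> M \<or> \<not> saturated M (last vs)"
      using \<open>S \<in> good_paths G M\<close> unfolding good_paths_def good_path_iff by blast
    then have "S \<noteq> {}"
      by (auto simp: alternating_path_def is_path_def simp flip: length_greater_0_conv)
    then show ?thesis
      using matching_sym_diff_good_path[OF M vs(2-)] edge_connected_walk[of vs] vs(1) by simp
  qed
  moreover have "S \<in> ?R" if "S \<in> good_cycles G M" for S
  proof -
    obtain vs where vs: "S = set (cycle_edges vs)" "alternating_cycle G M vs"
      using \<open>S \<in> good_cycles G M\<close> unfolding good_cycles_def by blast
    then have "S \<noteq> {}"
      by (auto simp: alternating_cycle_def is_cycle_def simp flip: length_greater_0_conv)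
    then show ?thesis
      using matching_sym_diff_good_cycle[OF M vs(2)] edge_connected_cycle[of vs] vs(1) by simp
  qed
  ultimately show "?L \<subseteq> ?R" by blast
qed

theorem theorem2p3:
  fixes G :: "'v::finite graph" and M :: "'v set set"
  assumes "finite_simple_graph G" and "matching G M"
  shows "vertex_degree (skeleton (matching_polytope G)) (incidence_vector M)
           = card (good_paths G M) + card (good_cycles G M)"
proof -
  \<comment> \<open>Both families are finite, as the vertex type is, and no edge set is both a good
    path and a good cycle.\<close>
  have "card (good_paths G M \<union> good_cycles G M) = card (good_paths G M) + card (good_cycles G M)"
    by (simp add: card_Un_disjoint good_paths_good_cycles_disjoint)
  then show ?thesis
    using vertex_degree_skeleton[OF assms(2)] good_paths_un_good_cycles[OF assms] by simp
qed

end
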